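(* Let $\mu$ be a real number with $1\le\mu<\theta^{-1}$, and let $(n_k)_{k\in\mathbb{N}}$ be a sequence of positive integers such that $n_k=p_k^{j_k}$ for all $k$, where $p_k$ is a prime and $j_k\in\mathbb{N}$. If $n_k\to\infty$ as $k\to\infty$, then $T_{n_k}(\mu)\to\infty$ as $k\to\infty$.
   Context: $\mathbb{N}$ is the set of positive integers. $\tau(n)$ denotes the number of positive divisors of the positive integer $n$. For real $\mu>0$ and a positive integer $n$, $$T_n(\mu)=\frac{\max_{1\le m\le n^{1/\mu}}\tau(n+m)}{\tau(n)},$$ where the maximum is over integers $m$ in the indicated range. Here $p_k$ denotes an arbitrary prime depending on $k$ (not the $k$-th prime). The constant $\theta$ is defined by $$\theta=\inf\Big\{\lambda>0 \;:\; \sum_{k=1}^N\tau(k)=N\ln N+(2\gamma-1)N+O(N^{\lambda+\epsilon})\ \text{ for all }\epsilon>0\Big\},$$ where $\gamma$ is Euler's constant and the $O$-estimate is as $N\to\infty$ (implied constant may depend on $\epsilon$). *)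

theory Defs
  imports
    "HOL-Analysis.Analysis"
    "HOL-Library.Landau_Symbols"
    "HOL-Computational_Algebra.Primes"
begin

definition tau :: "nat \<Rightarrow> nat" where
  "tau n = card {d. d dvd n}"

text \<open>
  For \<open>n \<ge> 1\<close> and \<open>\<mu> > 0\<close> the index set below is finite and contains \<open>1\<close>, so the maximum is
  well defined.
\<close>

definition T :: "nat \<Rightarrow> real \<Rightarrow> real" where
  "T n \<mu> =
    real (Max ((\<lambda>m. tau (n + m)) ` {m. 1 \<le> m \<and> real m \<le> real n powr (1 / \<mu>)})) / real (tau n)"

text \<open>The infimum of admissible error exponents in the Dirichlet divisor problem.\<close>

definition theta :: real where
  "theta = Inf {r :: real. r > 0 \<and> (\<forall>\<epsilon>>0.
     (\<lambda>N::nat. (\<Sum>k=1..N. real (tau k))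
        - (real N * ln (real N) + (2 * euler_mascheroni - 1) * real N))
     \<in> O[at_top](\<lambda>N. real N powr (r + \<epsilon>)))}"

end

theory Submission
  imports Defs
begin

text \<open>
  Shifting \<open>n = p ^ j\<close> by \<open>m = p ^ a * m'\<close> with \<open>a\<close> close to \<open>j / \<mu>\<close> keeps the factor \<open>p ^ a\<close>,
  so \<open>\<tau>(n + m)\<close> already is a fixed proportion of \<open>\<tau>(n) = j + 1\<close>; a bounded \<open>m'\<close> suffices to make
  the cofactor \<open>p ^ (j - a) + m'\<close> divisible by \<open>q ^ K\<close> for a prime \<open>q \<noteq> p\<close>, which gains a factor
  \<open>K + 1\<close> with \<open>K\<close> arbitrary. This needs \<open>j\<close> large; if \<open>j\<close> is bounded, so is \<open>\<tau>(n)\<close>, and one takes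
  \<open>n + m\<close> divisible by a large power of 2.
\<close>

lemma tau_mono_dvd:
  assumes "d dvd n" "n > 0"
  shows "tau d \<le> tau n"
  unfolding tau_def
  using assms by (intro card_mono) (auto intro: dvd_trans)

lemma tau_prime_power:
  assumes "prime p"
  shows "tau (p ^ k) = k + 1"
proof -
  have "{d. d dvd p ^ k} = (\<lambda>i. p ^ i) ` {..k}"
    using divides_primepow_nat[OF assms] by auto
  moreover have "inj_on (\<lambda>i. p ^ i) {..k}"
    using prime_gt_1_nat[OF assms] by (auto intro!: inj_onI)
  ultimately show ?thesis
    by (simp add: tau_def card_image)
qed

text \<open>By coprimality, a product of a divisor of \<open>a\<close> and a divisor of
  \<open>b\<close> determines both factors, so distinct pairs give distinct divisors of
  \<open>a * b\<close>.\<close>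

lemma tau_mult_ge_coprime:
  assumes "coprime a b" "a > 0" "b > 0"
  shows "tau a * tau b \<le> tau (a * b)"
proof -
  have inj: "inj_on (\<lambda>(x, y). x * y) ({d. d dvd a} \<times> {d. d dvd b})"
  proof (rule inj_onI, clarsimp)
    fix x y u v :: nat
    assume d: "x dvd a" "y dvd b" "u dvd a" "v dvd b" and eq: "x * y = u * v"
    have "coprime x v" "coprime u y"
      using d assms(1) coprime_divisors by blast+
    hence "x dvd u" "u dvd x"
      using eq by (metis coprime_dvd_mult_left_iff dvd_triv_left)+
    hence "x = u"
      by (rule dvd_antisym)
    moreover have "x > 0"
      using d(1) assms(2) by (auto intro: dvd_pos_nat)
    ultimately show "x = u \<and> y = v"
      using eq by simp
  qed
  have "tau a * tau b = card ((\<lambda>(x, y). x * y) ` ({d. d dvd a} \<times> {d. d dvd b}))"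
    by (simp add: tau_def card_image[OF inj] card_cartesian_product)
  also have "\<dots> \<le> tau (a * b)"
    unfolding tau_def using assms by (intro card_mono) (auto intro: mult_dvd_mono)
  finally show ?thesis .
qed

lemma exists_shift_dvd:
  fixes x Q :: nat
  assumes "Q > 0"
  obtains m where "1 \<le> m" "m \<le> Q" "Q dvd x + m"
proof
  \<comment> \<open>If \<open>Q\<close> divides \<open>x\<close>, this witness is \<open>Q\<close>
    rather than 0, so the shift stays positive.\<close>
  show "1 \<le> Q - x mod Q" "Q - x mod Q \<le> Q"
    using assms by (simp_all add: Suc_le_eq)
  have "x + (Q - x mod Q) = Q * (x div Q + 1)"
    using mod_less_divisor[OF assms, of x] mult_div_mod_eq[of Q x]
    unfolding distrib_left by linarith
  thus "Q dvd x + (Q - x mod Q)"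
    by (metis dvd_triv_left)
qed

lemma T_ge:
  assumes "1 \<le> m" "real m \<le> real n powr (1 / \<mu>)"
  shows "real (tau (n + m)) / real (tau n) \<le> T n \<mu>"
proof -
  have "{m. 1 \<le> m \<and> real m \<le> real n powr (1 / \<mu>)} \<subseteq> {..nat \<lfloor>real n powr (1 / \<mu>)\<rfloor>}"
    by (auto simp: le_nat_floor)
  hence "finite {m. 1 \<le> m \<and> real m \<le> real n powr (1 / \<mu>)}"
    by (rule finite_subset) simp
  hence "tau (n + m) \<le> Max ((\<lambda>m. tau (n + m)) ` {m. 1 \<le> m \<and> real m \<le> real n powr (1 / \<mu>)})"
    using assms by (intro Max_ge) auto
  thus ?thesis
    unfolding T_def by (intro divide_right_mono) auto
qed

text \<open>The factor 4 in the denominator is 2 * 2: at most half of the exponent \<open>s\<close>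
  is given up to make room for the cofactor, and \<open>j + 1 \<le> 2 * j\<close>.\<close>

lemma T_prime_power_ge_large_exponent:
  fixes \<mu> :: real
  assumes \<mu>: "1 \<le> \<mu>" and p: "prime p" and j: "4 * real K \<le> real j / \<mu>" "1 \<le> j"
  shows "(real K + 1) / (4 * \<mu>) \<le> T (p ^ j) \<mu>"
proof -
  \<comment> \<open>A prime other than \<open>p\<close>, bounded independently of \<open>p\<close>:
    \<open>q \<le> 4 \<le> p ^ 2\<close> will give \<open>q ^ K \<le> p ^ (2 * K)\<close>.\<close>
  define q :: nat where "q = (if p = 2 then 3 else 2)"
  have q: "prime q" "q \<noteq> p" "q \<le> 4"
    by (auto simp: q_def)
  have q_pos: "q ^ K > 0" and p_pos: "p > 0"
    using q(1) p by (simp_all add: prime_gt_0_nat)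
  \<comment> \<open>The largest exponent for which \<open>p ^ s\<close> is still an admissible
    shift.\<close>
  define s where "s = nat \<lfloor>real j / \<mu>\<rfloor>"
  have s: "real s \<le> real j / \<mu>" "real j / \<mu> < real s + 1"
    using \<mu> by (simp_all add: s_def)
  have s_ge: "4 * K \<le> s"
    using j(1) by (simp add: s_def le_nat_floor)
  have "real j / \<mu> \<le> real j"
    using \<mu> mult_right_mono[of 1 \<mu> "real j"] by (simp add: field_simps)
  hence s_le: "s \<le> j"
    using s(1) by linarith
  \<comment> \<open>The reserve \<open>2 * K\<close> pays for the multiplier
    \<open>m \<le> q ^ K \<le> p ^ (2 * K)\<close>, so that \<open>p ^ a * m \<le> p ^ s\<close>.
    Since \<open>4 * K \<le> s\<close>, at least half of \<open>s\<close> remains.\<close>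
  define a where "a = s - 2 * K"
  have a: "a \<le> j" "a + 2 * K = s" "s \<le> 2 * a"
    using s_ge s_le by (auto simp: a_def)
  obtain m where m: "1 \<le> m" "m \<le> q ^ K" "q ^ K dvd p ^ (j - a) + m"
    using exists_shift_dvd[OF q_pos] by metis
  have "q ^ K \<le> 4 ^ K"
    using q(3) by (rule power_mono) simp
  also have "(4::nat) ^ K = 2 ^ (2 * K)"
    by (simp add: power_mult)
  also have "\<dots> \<le> p ^ (2 * K)"
    using prime_ge_2_nat[OF p] by (rule power_mono) simp
  finally have "p ^ a * m \<le> p ^ s"
    using m(2) a(2) by (metis le_trans mult_le_mono2 power_add)
  hence "real (p ^ a * m) \<le> real p powr real s"
    using p_pos by (simp add: powr_realpow del: of_nat_mult flip: of_nat_power)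
  also have "\<dots> \<le> real p powr (real j / \<mu>)"
    using s(1) p_pos by (intro powr_mono) auto
  also have "\<dots> = real (p ^ j) powr (1 / \<mu>)"
    using p_pos by (simp add: powr_powr flip: powr_realpow)
  finally have "real (tau (p ^ j + p ^ a * m)) / real (tau (p ^ j)) \<le> T (p ^ j) \<mu>"
    using m(1) p_pos by (intro T_ge) auto
  moreover have "(real K + 1) / (4 * \<mu>) \<le> real (tau (p ^ j + p ^ a * m)) / real (tau (p ^ j))"
  proof -
    \<comment> \<open>The shifted number is a multiple of \<open>p ^ a * q ^ K\<close>, whose two
      factors contribute \<open>a + 1\<close> and \<open>K + 1\<close> independently.\<close>
    have "coprime (p ^ a) (q ^ K)"
      using p q by (simp add: primes_coprime)
    hence "(a + 1) * (K + 1) \<le> tau (p ^ a * q ^ K)"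
      using tau_mult_ge_coprime[of "p ^ a" "q ^ K"] q_pos p_pos
      by (simp add: tau_prime_power p q(1))
    also have "\<dots> \<le> tau (p ^ a * (p ^ (j - a) + m))"
      using m p_pos by (intro tau_mono_dvd mult_dvd_mono) auto
    also have "p ^ a * (p ^ (j - a) + m) = p ^ j + p ^ a * m"
      using a(1) by (simp add: distrib_left flip: power_add)
    finally have "real ((a + 1) * (K + 1)) \<le> real (tau (p ^ j + p ^ a * m))"
      by (simp only: of_nat_le_iff)
    hence tau_ge: "(real a + 1) * (real K + 1) \<le> real (tau (p ^ j + p ^ a * m))"
      by (simp add: algebra_simps)
    have "real j / \<mu> \<le> 2 * (real a + 1)"
      using s(2) of_nat_mono[OF a(3), where 'a = real] by simp
    hence "real j \<le> 2 * \<mu> * (real a + 1)"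
      using \<mu> by (simp add: field_simps)
    moreover have "real j + 1 \<le> 2 * real j"
      using j(2) by simp
    ultimately have "real j + 1 \<le> 4 * \<mu> * (real a + 1)"
      by linarith
    hence "(real K + 1) * (real j + 1) \<le> (real K + 1) * (4 * \<mu> * (real a + 1))"
      by (rule mult_left_mono) simp
    also have "\<dots> = 4 * \<mu> * ((real a + 1) * (real K + 1))"
      by (simp add: algebra_simps)
    also have "\<dots> \<le> 4 * \<mu> * real (tau (p ^ j + p ^ a * m))"
      using tau_ge \<mu> by (intro mult_left_mono) auto
    finally show ?thesis
      using \<mu> by (simp add: tau_prime_power p field_simps)
  qed
  ultimately show ?thesis
    by linarith
qed

text \<open>The hypothesis says \<open>2 ^ L \<le> n powr (1 / \<mu>)\<close>, so the admissible
  shifts cover every residue class modulo \<open>2 ^ L\<close> and some \<open>n + m\<close> has at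
  least the \<open>L + 1\<close> divisors of \<open>2 ^ L\<close>.\<close>

lemma T_ge_powr:
  fixes \<mu> :: real
  assumes \<mu>: "0 < \<mu>" and n: "(2 ^ L) powr \<mu> \<le> real n"
  shows "(real L + 1) / real (tau n) \<le> T n \<mu>"
proof -
  obtain m where m: "1 \<le> m" "m \<le> 2 ^ L" "2 ^ L dvd n + m"
    using exists_shift_dvd[of "2 ^ L" n] by auto
  have "real m \<le> 2 ^ L"
    using m(2) by (metis of_nat_le_iff of_nat_numeral of_nat_power)
  also have "\<dots> = ((2 ^ L) powr \<mu>) powr (1 / \<mu>)"
    using \<mu> by (simp add: powr_powr)
  also have "\<dots> \<le> real n powr (1 / \<mu>)"
    using n \<mu> by (intro powr_mono2) auto
  finally have "real (tau (n + m)) / real (tau n) \<le> T n \<mu>"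
    using m(1) by (intro T_ge)
  moreover have "L + 1 \<le> tau (n + m)"
    using tau_mono_dvd[OF m(3)] m(1) by (simp add: tau_prime_power)
  hence "(real L + 1) / real (tau n) \<le> real (tau (n + m)) / real (tau n)"
    by (intro divide_right_mono) auto
  ultimately show ?thesis
    by linarith
qed

text \<open>The threshold \<open>N\<close> depends only on \<open>\<mu>\<close> and
  \<open>C\<close>, uniformly in \<open>p\<close> and \<open>j\<close>, so a sequence may mix
  bounded and unbounded exponents freely.\<close>

lemma T_prime_power_unbounded:
  fixes \<mu> C :: real
  assumes \<mu>: "1 \<le> \<mu>"
  obtains N :: nat where "\<And>p j. prime p \<Longrightarrow> 1 \<le> j \<Longrightarrow> N \<le> p ^ j \<Longrightarrow> C \<le> T (p ^ j) \<mu>"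
proof -
  \<comment> \<open>\<open>K\<close> settles the exponents \<open>j \<ge> 4 * K * \<mu>\<close>. For
    smaller ones \<open>tau (p ^ j) = j + 1\<close> is bounded in terms of \<open>K\<close>, and
    \<open>L\<close> outweighs that bound; \<open>N\<close> then makes \<open>2 ^ L\<close> an
    admissible shift. The absolute value of \<open>C\<close> keeps the multiplier
    nonnegative.\<close>
  obtain K :: nat where K: "C * (4 * \<mu>) \<le> real K"
    using real_arch_simple by blast
  obtain L :: nat where L: "\<bar>C\<bar> * (4 * real K * \<mu> + 1) \<le> real L"
    using real_arch_simple by blast
  obtain N :: nat where N: "(2 ^ L) powr \<mu> \<le> real N"
    using real_arch_simple by blast
  show ?thesis
  proof (rule that[of N])
    fix p j :: nat
    assume p: "prime p" and j: "1 \<le> j" and le: "N \<le> p ^ j"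
    show "C \<le> T (p ^ j) \<mu>"
    proof (cases "4 * real K \<le> real j / \<mu>")
      case True
      have "C \<le> (real K + 1) / (4 * \<mu>)"
        using K \<mu> by (simp add: field_simps)
      also have "\<dots> \<le> T (p ^ j) \<mu>"
        using T_prime_power_ge_large_exponent[OF \<mu> p True j] .
      finally show ?thesis .
    next
      case False
      hence "real j + 1 \<le> 4 * real K * \<mu> + 1"
        using \<mu> by (simp add: field_simps)
      hence "\<bar>C\<bar> * (real j + 1) \<le> \<bar>C\<bar> * (4 * real K * \<mu> + 1)"
        by (rule mult_left_mono) simp
      hence "\<bar>C\<bar> * (real j + 1) \<le> real L + 1"
        using L by linarith
      hence "\<bar>C\<bar> \<le> (real L + 1) / real (tau (p ^ j))"
        by (simp add: tau_prime_power p field_simps)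
      also have "(2 ^ L) powr \<mu> \<le> real (p ^ j)"
        using N le by (meson of_nat_le_iff order_trans)
      hence "(real L + 1) / real (tau (p ^ j)) \<le> T (p ^ j) \<mu>"
        using \<mu> by (intro T_ge_powr) auto
      finally show ?thesis
        by linarith
    qed
  qed
qed

theorem theorem1p2:
  fixes \<mu> :: real and n p j :: "nat \<Rightarrow> nat"
  assumes "1 \<le> \<mu>" and "\<mu> < inverse theta"
    and "\<And>k. k \<ge> 1 \<Longrightarrow> n k = p k ^ j k"
    and "\<And>k. k \<ge> 1 \<Longrightarrow> prime (p k)"
    and "\<And>k. k \<ge> 1 \<Longrightarrow> j k \<ge> 1"
    and "filterlim n at_top at_top"
  shows "filterlim (\<lambda>k. T (n k) \<mu>) at_top at_top"
  unfolding filterlim_at_top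
proof
  fix C :: real
  obtain N where N: "\<And>p j. prime p \<Longrightarrow> 1 \<le> j \<Longrightarrow> N \<le> p ^ j \<Longrightarrow> C \<le> T (p ^ j) \<mu>"
    using T_prime_power_unbounded[OF assms(1)] by blast
  have "eventually (\<lambda>k. N \<le> n k) at_top"
    using assms(6) by (simp add: filterlim_at_top)
  \<comment> \<open>Index 0 is discarded, as the prime power form is assumed only from 1 on.\<close>
  thus "eventually (\<lambda>k. C \<le> T (n k) \<mu>) at_top"
    using eventually_ge_at_top[of 1] by eventually_elim (use N assms(3-5) in simp)
qed

end
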